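(* Let $\lambda>0$, let $E\subseteq\{1,\ldots,m\}\times\{1,\ldots,n\}$, and let $\mathbf{Y}\in\mathbb{R}^{m\times n}$. For any $p\in[1,\infty]$ one has that $$\min_{\mathbf{X}\in\mathbb{R}^{m\times n}} \max_{\boldsymbol\Delta\in\mathcal{U}_{(\sigma_p,\mathrm{P}(F_2))}} \|\mathbf{Y}-\mathbf{X}-\boldsymbol\Delta(\mathbf{X})\|_{\mathrm{P}(F_2)} = \min_{\mathbf{X}\in\mathbb{R}^{m\times n}} \left[\|\mathbf{Y}-\mathbf{X}\|_{\mathrm{P}(F_2)} + \lambda \|\mathbf{X}\|_{\sigma_p}\right].$$ In particular, for $p=1$ the right-hand side is the nuclear norm penalized matrix completion problem $\min_{\mathbf{X}} \|\mathbf{Y}-\mathbf{X}\|_{\mathrm{P}(F_2)}+\lambda \|\mathbf{X}\|_{\sigma_1}$.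
   Context: $\|\mathbf{Z}\|_{\mathrm{P}(F_2)}=\left(\sum_{(i,j)\in E}Z_{ij}^2\right)^{1/2}$ is the projected $2$-Frobenius seminorm; $E$ is the set of observed entries, and unobserved entries of $\mathbf{Y}$ are set to $0$ without loss of generality (they do not affect the problem). $\|\mathbf{X}\|_{\sigma_p}$ is the Schatten norm, i.e. the $\ell_p$ norm of the vector of singular values of $\mathbf{X}$ ($\sigma_1$ is the nuclear norm). The uncertainty set is $$\mathcal{U}_{(\sigma_p,\mathrm{P}(F_2))}=\{\boldsymbol\Delta:\mathbb{R}^{m\times n}\to\mathbb{R}^{m\times n}\text{ linear}:\ \|\boldsymbol\Delta(\mathbf{X})\|_{\mathrm{P}(F_2)}\le\lambda\|\mathbf{X}\|_{\sigma_p}\ \forall\,\mathbf{X}\in\mathbb{R}^{m\times n}\}.$$ *)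

theory Defs
  imports "HOL-Analysis.Analysis" "HOL-Library.Multiset"
begin

definition proj_frob :: "('m::finite \<times> 'n::finite) set \<Rightarrow> real^'n^'m \<Rightarrow> real" where
  "proj_frob E Z = sqrt (\<Sum>(i, j)\<in>E. (Z $ i $ j)\<^sup>2)"

definition sv_space :: "real^'n^'m \<Rightarrow> real \<Rightarrow> (real^'n) set" where
  "sv_space X s = {v. (transpose X ** X) *v v = s\<^sup>2 *\<^sub>R v}"

definition is_singular_value :: "real^'n^'m \<Rightarrow> real \<Rightarrow> bool" where
  "is_singular_value X s \<longleftrightarrow> 0 \<le> s \<and> (\<exists>v. v \<noteq> 0 \<and> v \<in> sv_space X s)"

(* The nonnegative square roots of the eigenvalues of the symmetric matrix X^T X, each repeated
   according to the dimension of its eigenspace. For X with m rows and n columns this is a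
   multiset of n numbers; if m < n, it contains n - m zeros more than the usual list of
   min m n singular values, which does not affect any l_p norm. *)
definition singular_values :: "real^'n^'m \<Rightarrow> real multiset" where
  "singular_values X = (\<Sum>s | is_singular_value X s. replicate_mset (dim (sv_space X s)) s)"

(* Only used for 1 \<le> p. Inserting 0 makes Max total and does not change the norm of a
   nonempty vector. *)
definition lp_norm :: "ereal \<Rightarrow> real multiset \<Rightarrow> real" where
  "lp_norm p M =
     (if p = \<infinity> then Max (insert 0 (abs ` set_mset M))
      else (\<Sum>x\<in>#M. \<bar>x\<bar> powr real_of_ereal p) powr (1 / real_of_ereal p))"

definition schatten_norm :: "ereal \<Rightarrow> real^'n^'m \<Rightarrow> real" where
  "schatten_norm p X = lp_norm p (singular_values X)"

definition nuclear_norm :: "real^'n^'m \<Rightarrow> real" where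
  "nuclear_norm X = (\<Sum>s\<in>#singular_values X. s)"

definition uncertainty_set ::
  "real \<Rightarrow> ereal \<Rightarrow> ('m::finite \<times> 'n::finite) set \<Rightarrow> (real^'n^'m \<Rightarrow> real^'n^'m) set" where
  "uncertainty_set lam p E =
     {D. linear D \<and> (\<forall>X. proj_frob E (D X) \<le> lam * schatten_norm p X)}"

(* The sum defining singular_values ranges over a finite set, so it is never the default value
   of an infinite sum. *)
lemma finite_singular_values:
  fixes X :: "real^'n^'m"
  shows "finite {s. is_singular_value X s}"
proof -
  define A where "A = transpose X ** X"
  have sym: "(A *v v) \<bullet> w = v \<bullet> (A *v w)" for v w
    by (simp add: A_def dot_lmul_matrix [symmetric] matrix_transpose_mul
        flip: transpose_matrix_vector)
  define f where "f s = (SOME v. v \<noteq> 0 \<and> v \<in> sv_space X s)" for s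
  have f: "f s \<noteq> 0" "A *v f s = s\<^sup>2 *\<^sub>R f s" if "is_singular_value X s" for s
  proof -
    have "f s \<noteq> 0 \<and> f s \<in> sv_space X s"
      unfolding f_def by (rule someI_ex) (use that in \<open>simp add: is_singular_value_def\<close>)
    then show "f s \<noteq> 0" "A *v f s = s\<^sup>2 *\<^sub>R f s"
      by (auto simp: sv_space_def A_def)
  qed
  have orth: "f s \<bullet> f t = 0"
    if "is_singular_value X s" "is_singular_value X t" "s \<noteq> t" for s t
  proof -
    have "s\<^sup>2 * (f s \<bullet> f t) = t\<^sup>2 * (f s \<bullet> f t)"
      using sym [of "f s" "f t"] f that by simp
    moreover have "s\<^sup>2 \<noteq> t\<^sup>2"
      using that by (auto simp: is_singular_value_def)
    ultimately show ?thesis by simp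
  qed
  have inj: "inj_on f {s. is_singular_value X s}"
    by (rule inj_onI) (metis mem_Collect_eq orth f(1) inner_eq_zero_iff)
  have "pairwise orthogonal (f ` {s. is_singular_value X s})"
    by (auto simp: pairwise_def orthogonal_def intro: orth)
  then have "independent (f ` {s. is_singular_value X s})"
    by (rule pairwise_orthogonal_independent) (use f(1) in force)
  then have "finite (f ` {s. is_singular_value X s})"
    by (rule independent_imp_finite)
  then show ?thesis
    using inj by (simp add: finite_image_iff)
qed

lemma count_singular_values:
  "count (singular_values X) s = (if is_singular_value X s then dim (sv_space X s) else 0)"
  by (simp add: singular_values_def count_sum finite_singular_values
      sum.delta' if_distrib cong: if_cong)

end

(* The adversary can always align Delta(X) with -(Y - X) on E, at full length lam * ||X||, by a
   rank one map Delta(Z) = lam * f(Z) * V, provided that some linear functional f is bounded by the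
   Schatten norm and satisfies f(X) = ||X||. So for nonempty E the inner maximum equals the
   penalized objective pointwise, and for empty E both sides are 0.
   The functional f is built without trace duality: if a_b, b are the left and right singular
   vectors of X, put f(Z) = sum_b w_b <a_b, Z b> with weights w norming the singular values in l_p.
   Expanding Z in its own singular vectors, the numbers <a_b, Z b> arise from the singular values
   of Z by a doubly substochastic matrix, hence their l_p norm is at most ||Z||. *)
theory Submission imports Defs begin

section \<open>Eigenvectors and orthonormal singular bases\<close>

text \<open>A maximizer \<open>v\<close> of the Rayleigh quotient over the unit sphere of
  \<open>W\<close> is an eigenvector: the residual \<open>f v - m *\<^sub>R v\<close> lies in
  \<open>W\<close> and is orthogonal to \<open>v\<close>, and moving \<open>v\<close> along a
  nonzero residual would increase the quotient to first order.\<close>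

lemma selfadjoint_eigenvector_subspace:
  fixes f :: "'a::euclidean_space \<Rightarrow> 'a"
  assumes "linear f" and self: "\<And>x y. f x \<bullet> y = x \<bullet> f y"
    and W: "subspace W" "f ` W \<subseteq> W" "W \<noteq> {0}"
  obtains v where "v \<in> W" "norm v = 1" "f v = (v \<bullet> f v) *\<^sub>R v"
proof -
  interpret linear f by fact
  define S where "S = sphere 0 1 \<inter> W"
  obtain w where w: "w \<in> W" "w \<noteq> 0"
    using W subspace_0 by blast
  have "compact S"
    unfolding S_def using closed_subspace[OF W(1)] by (intro compact_Int_closed) auto
  moreover have "w /\<^sub>R norm w \<in> S"
    unfolding S_def using w W(1) by (simp add: subspace_scale)
  moreover have "continuous_on S (\<lambda>x. x \<bullet> f x)"
    using linear_continuous_on linear_linear \<open>linear f\<close> by (intro continuous_intros) auto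
  ultimately obtain v where v: "v \<in> S" and max: "\<And>x. x \<in> S \<Longrightarrow> x \<bullet> f x \<le> v \<bullet> f v"
    using continuous_attains_sup[of S "\<lambda>x. x \<bullet> f x"] by blast
  define m where "m = v \<bullet> f v"
  have vW: "v \<in> W" and v1: "norm v = 1"
    using v by (auto simp: S_def)
  have q: "x \<bullet> f x \<le> m * (x \<bullet> x)" if "x \<in> W" for x
  proof (cases "x = 0")
    case False
    then have "x /\<^sub>R norm x \<in> S"
      unfolding S_def using that W(1) by (simp add: subspace_scale)
    from max[OF this] show ?thesis
      using False by (simp add: m_def scale field_simps power2_norm_eq_inner[symmetric] power2_eq_square)
  qed simp
  define w where "w = f v - m *\<^sub>R v"
  have wW: "w \<in> W"
    unfolding w_def using vW W by (intro subspace_diff subspace_scale) auto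
  have "w = 0"
  proof (rule ccontr)
    assume "w \<noteq> 0"
    have vv: "v \<bullet> v = 1"
      using v1 by (simp add: norm_eq_1)
    have vw: "v \<bullet> w = 0"
      by (simp add: w_def inner_diff_right m_def vv)
    have fvw: "f v \<bullet> w = w \<bullet> w"
      using vw by (simp add: w_def inner_diff_left inner_diff_right algebra_simps m_def)
    \<comment> \<open>This is \<open>q\<close> at \<open>v + t *\<^sub>R w\<close>. The left side is
      linear in \<open>t\<close> and the right side quadratic, which is impossible for small
      positive \<open>t\<close> when \<open>w\<close> is nonzero.\<close>
    have bound: "2 * t * (w \<bullet> w) \<le> t\<^sup>2 * (m * (w \<bullet> w) - w \<bullet> f w)" for t
    proof -
      have "v + t *\<^sub>R w \<in> W"
        using vW wW W(1) by (simp add: subspace_add subspace_scale)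
      from q[OF this] have "m + 2 * t * (f v \<bullet> w) + t\<^sup>2 * (w \<bullet> f w)
          \<le> m * (1 + t\<^sup>2 * (w \<bullet> w))"
        using self[of v w]
        by (simp add: add scale inner_add_left inner_add_right vv vw inner_commute[of w v]
          inner_commute[of w "f v"] m_def power2_eq_square algebra_simps)
      then show ?thesis by (simp add: fvw algebra_simps)
    qed
    define c where "c = m * (w \<bullet> w) - w \<bullet> f w"
    have "c \<ge> 0" using q[OF wW] by (simp add: c_def)
    have "w \<bullet> w > 0" using \<open>w \<noteq> 0\<close> by simp
    show False
    proof (cases "c = 0")
      case True
      then show False using bound[of 1] \<open>w \<bullet> w > 0\<close> by (simp add: c_def)
    next
      case False
      with \<open>c \<ge> 0\<close> have "c > 0" by simp
      \<comment> \<open>At this \<open>t\<close> the right side of the bound is exactly half of the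
        left side.\<close>
      with bound[of "(w \<bullet> w) / c"] have "(w \<bullet> w) * (w \<bullet> w) \<le> 0"
        unfolding c_def[symmetric] by (simp add: field_simps power2_eq_square)
      with mult_pos_pos[OF \<open>w \<bullet> w > 0\<close> \<open>w \<bullet> w > 0\<close>] show False
        by linarith
    qed
  qed
  then show ?thesis
    using that[OF vW v1] by (simp add: w_def m_def)
qed

lemma inner_gram_matrix: "x \<bullet> ((transpose X ** X) *v y) = (X *v x) \<bullet> (X *v y)"
  for X :: "real^'n^'m"
  by (metis dot_lmul_matrix matrix_vector_mul_assoc transpose_matrix_vector transpose_transpose)

text \<open>Orthonormal bases of the eigenspaces of \<open>transpose X ** X\<close> are joined into
  one basis of right singular vectors. It replaces the eigenspace dimensions in the definition of
  \<open>singular_values\<close> by the lengths \<open>norm (X *v b)\<close>, so that sums over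
  singular values become sums over \<open>B\<close>.\<close>

lemma singular_basis:
  fixes X :: "real^'n^'m"
  obtains B where "finite B" "pairwise orthogonal B" "\<And>b. b \<in> B \<Longrightarrow> norm b = 1"
    "span B = UNIV"
    "\<And>b c. b \<in> B \<Longrightarrow> c \<in> B \<Longrightarrow> b \<noteq> c \<Longrightarrow> (X *v b) \<bullet> (X *v c) = 0"
    "singular_values X = image_mset (\<lambda>b. norm (X *v b)) (mset_set B)"
proof -
  define A where "A = transpose X ** X"
  have inner_A: "x \<bullet> (A *v y) = (X *v x) \<bullet> (X *v y)" for x y
    unfolding A_def by (rule inner_gram_matrix)
  have sub: "subspace (sv_space X s)" for s
    unfolding sv_space_def
    by (auto simp: subspace_def matrix_vector_right_distrib matrix_vector_mult_scaleR algebra_simps)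
  define S where "S = {s. is_singular_value X s}"
  have "\<exists>B. B \<subseteq> sv_space X s \<and> pairwise orthogonal B \<and> (\<forall>x\<in>B. norm x = 1) \<and>
      independent B \<and> card B = dim (sv_space X s) \<and> span B = sv_space X s" for s
    using orthonormal_basis_subspace[OF sub[of s]] by metis
  then obtain C where C: "\<And>s. C s \<subseteq> sv_space X s" "\<And>s. pairwise orthogonal (C s)"
    "\<And>s x. x \<in> C s \<Longrightarrow> norm x = 1" "\<And>s. independent (C s)"
    "\<And>s. card (C s) = dim (sv_space X s)" "\<And>s. span (C s) = sv_space X s"
    by metis
  define B where "B = (\<Union>s\<in>S. C s)"
  have Ab: "A *v b = s\<^sup>2 *\<^sub>R b" if "b \<in> C s" for b s
    using C(1)[of s] that by (auto simp: sv_space_def A_def)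
  have Xb: "norm (X *v b) = s" if "b \<in> C s" "s \<in> S" for b s
  proof -
    have "(norm (X *v b))\<^sup>2 = s\<^sup>2"
      using inner_A[of b b] Ab[OF that(1)] C(3)[OF that(1)]
      by (simp add: power2_norm_eq_inner norm_eq_1)
    then show ?thesis
      using that by (simp add: S_def is_singular_value_def)
  qed
  have fin: "finite B"
    unfolding B_def S_def using finite_singular_values C(4) independent_imp_finite by blast
  have nB: "norm b = 1" if "b \<in> B" for b
    using that C(3) by (auto simp: B_def)
  have orth: "b \<bullet> c = 0" if bc: "b \<in> B" "c \<in> B" "b \<noteq> c" for b c
  proof -
    obtain s t where st: "s \<in> S" "t \<in> S" "b \<in> C s" "c \<in> C t"
      using bc(1,2) unfolding B_def by blast
    show ?thesis
    proof (cases "s = t")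
      case True
      then show ?thesis
        using C(2)[of s] st bc by (auto simp: pairwise_def orthogonal_def)
    next
      case False
      have "s\<^sup>2 * (b \<bullet> c) = t\<^sup>2 * (b \<bullet> c)"
        using inner_A[of b c] inner_A[of c b] Ab st by (simp add: inner_commute)
      moreover have "s\<^sup>2 \<noteq> t\<^sup>2"
        using False st by (simp add: S_def is_singular_value_def)
      ultimately show ?thesis by simp
    qed
  qed
  have orthX: "(X *v b) \<bullet> (X *v c) = 0" if bc: "b \<in> B" "c \<in> B" "b \<noteq> c" for b c
  proof -
    obtain t where "c \<in> C t" using bc(2) unfolding B_def by blast
    then show ?thesis
      using inner_A[of b c] orth[OF bc] Ab by simp
  qed
  \<comment> \<open>Otherwise the orthogonal complement \<open>W\<close> of \<open>B\<close> is
    nonzero and invariant under \<open>A\<close>, so it contains a unit eigenvector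
    \<open>v\<close>. Its eigenvalue is the square of \<open>norm (X *v v)\<close>, hence its
    eigenspace is already spanned by part of \<open>B\<close>, and \<open>v\<close> would be
    orthogonal to itself.\<close>
  have spanB: "span B = UNIV"
  proof (rule ccontr)
    assume "span B \<noteq> UNIV"
    define W where "W = {y. \<forall>x\<in>B. orthogonal x y}"
    have "span B \<subset> span UNIV"
      using \<open>span B \<noteq> UNIV\<close> by auto
    then obtain w where "w \<noteq> 0" "\<And>y. y \<in> span B \<Longrightarrow> orthogonal w y"
      using orthogonal_to_subspace_exists_gen by blast
    then have w: "w \<noteq> 0" "w \<in> W"
      using span_base by (auto simp: W_def orthogonal_commute)
    have "(A *v x) \<in> W" if "x \<in> W" for x
      unfolding W_def
    proof safe
      fix b assume "b \<in> B"
      then obtain t where "b \<in> C t" by (auto simp: B_def)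
      then show "orthogonal b (A *v x)"
        using inner_A[of b x] inner_A[of x b] Ab[of b t] \<open>b \<in> B\<close> that
        by (simp add: W_def orthogonal_def inner_commute)
    qed
    moreover have "subspace W"
      unfolding W_def by (rule subspace_orthogonal_to_vectors)
    ultimately obtain v where v: "v \<in> W" "norm v = 1" "A *v v = (v \<bullet> (A *v v)) *\<^sub>R v"
      using selfadjoint_eigenvector_subspace[of "(*v) A" W] w inner_A
      by (metis (no_types, lifting) image_subsetI inner_commute matrix_vector_mul_linear
          singletonD)
    then have "A *v v = (norm (X *v v))\<^sup>2 *\<^sub>R v"
      by (simp add: inner_A power2_norm_eq_inner)
    then have vs: "v \<in> sv_space X (norm (X *v v))"
      by (simp add: sv_space_def A_def)
    moreover have "norm (X *v v) \<in> S"
      using v(2) vs by (auto simp: S_def is_singular_value_def intro!: exI[of _ v])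
    ultimately have "v \<in> span B"
      using C(6)[of "norm (X *v v)"] span_mono[of "C (norm (X *v v))" B] by (auto simp: B_def)
    then have "orthogonal v v"
      using v(1) orthogonal_to_span[of v B v] by (auto simp: W_def orthogonal_commute)
    then show False using v(2) by (simp add: orthogonal_self)
  qed
  have "singular_values X = image_mset (\<lambda>b. norm (X *v b)) (mset_set B)"
  proof (rule multiset_eqI)
    fix s
    \<comment> \<open>By \<open>Xb\<close> the stretching factor of a vector determines which
      \<open>C s\<close> it came from, so no vector of the union is shared between two
      eigenspaces.\<close>
    have "{b \<in> B. s = norm (X *v b)} = (if s \<in> S then C s else {})"
      using Xb by (auto simp: B_def)
    moreover have "count (image_mset (\<lambda>b. norm (X *v b)) (mset_set B)) s
        = (\<Sum>b | b \<in> B \<and> s = norm (X *v b). 1)"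
      unfolding count_image_mset' using fin by (intro sum.cong) auto
    ultimately show "count (singular_values X) s = count (image_mset (\<lambda>b. norm (X *v b)) (mset_set B)) s"
      using C(5)[of s] by (simp add: count_singular_values S_def)
  qed
  with fin nB orth orthX spanB that show thesis
    by (auto simp: pairwise_def orthogonal_def)
qed

section \<open>Duality and averaging for l_p norms\<close>

text \<open>Young's inequality with weights 1/r and (r - 1)/r, multiplied by \<open>r\<close>.
  Writing \<open>r - 1\<close> in place of a conjugate exponent keeps \<open>r = 1\<close> in the
  same argument; a zero \<open>t\<close> is harmless because \<open>0 powr x\<close> is 0 for every
  \<open>x\<close>.\<close>

lemma young_powr:
  fixes r s t :: real
  assumes "1 \<le> r" "0 \<le> s" "0 \<le> t"
  shows "r * (s * t powr (r - 1)) \<le> s powr r + (r - 1) * t powr r"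
proof (cases "s = 0 \<or> t = 0")
  case True
  then show ?thesis using assms by auto
next
  case False
  then have "(s powr r) powr (1/r) * (t powr r) powr ((r - 1)/r) \<le> 1/r * s powr r + (r - 1)/r * t powr r"
    using assms by (intro Youngs_inequality_0) (auto simp: field_simps)
  moreover have "r * ((r - 1) / r) = r - 1"
    using assms by simp
  ultimately show ?thesis
    using assms False by (simp add: powr_powr) (simp add: field_simps)
qed

lemma lp_norm_finite:
  "lp_norm (ereal r) (image_mset y (mset_set I)) = (\<Sum>i\<in>I. \<bar>y i\<bar> powr r) powr (1/r)"
  by (simp add: lp_norm_def sum_unfold_sum_mset multiset.map_comp o_def)

lemma lp_norm_infinity:
  "finite I \<Longrightarrow> lp_norm \<infinity> (image_mset y (mset_set I)) = Max (insert 0 ((\<lambda>i. \<bar>y i\<bar>) ` I))"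
  by (simp add: lp_norm_def image_image)

lemma lp_norm_nonneg: "0 \<le> lp_norm p M"
  by (simp add: lp_norm_def)

lemma abs_le_lp_norm_infinity:
  "finite I \<Longrightarrow> i \<in> I \<Longrightarrow> \<bar>y i\<bar> \<le> lp_norm \<infinity> (image_mset y (mset_set I))"
  by (simp add: lp_norm_infinity)

lemma ereal_ge_one_cases:
  assumes "1 \<le> (p::ereal)"
  obtains r where "p = ereal r" "1 \<le> r" | "p = \<infinity>"
  using assms by (cases p) auto

text \<open>The weights are the equality case of Hoelder's inequality: normalized powers of
  \<open>s\<close> for a finite exponent, and the indicator of one maximal index for exponent
  infinity.\<close>

lemma lp_norm_norming_weights:
  assumes p: "1 \<le> p" and I: "finite I" and s: "\<And>i. i \<in> I \<Longrightarrow> 0 \<le> s i"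
  obtains w where "(\<Sum>i\<in>I. w i * s i) = lp_norm p (image_mset s (mset_set I))"
    "\<And>y. \<bar>\<Sum>i\<in>I. w i * y i\<bar> \<le> lp_norm p (image_mset y (mset_set I))"
proof (cases "lp_norm p (image_mset s (mset_set I)) = 0")
  case True
  then show thesis
    using that[of "\<lambda>_. 0"] by (simp add: lp_norm_nonneg)
next
  case False
  define N where "N = lp_norm p (image_mset s (mset_set I))"
  have N: "N > 0"
    using False lp_norm_nonneg[of p "image_mset s (mset_set I)"] by (simp add: N_def)
  from p show thesis
  proof (cases rule: ereal_ge_one_cases)
    case (1 r)
    \<comment> \<open>For \<open>r = 1\<close> this is the indicator of
      \<open>s i \<noteq> 0\<close>, since \<open>0 powr 0\<close> is 0.\<close>
    define w where "w i = (s i / N) powr (r - 1)" for i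
    have Nr: "N powr r = (\<Sum>i\<in>I. s i powr r)"
      using 1 s by (simp add: N_def lp_norm_finite powr_powr sum_nonneg)
    have norm1: "(\<Sum>i\<in>I. (s i / N) powr r) = 1"
      using N s by (simp add: powr_divide Nr[symmetric] sum_divide_distrib[symmetric] cong: sum.cong)
    have "(\<Sum>i\<in>I. w i * s i) = (\<Sum>i\<in>I. N * (s i / N) powr r)"
    proof (rule sum.cong)
      fix i assume "i \<in> I"
      then show "w i * s i = N * (s i / N) powr r"
        using N s[of i] by (cases "s i = 0") (simp_all add: w_def powr_diff)
    qed simp
    then have "(\<Sum>i\<in>I. w i * s i) = N"
      by (simp add: sum_distrib_left[symmetric] norm1)
    moreover have "\<bar>\<Sum>i\<in>I. w i * y i\<bar> \<le> lp_norm p (image_mset y (mset_set I))" for y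
    proof -
      define M where "M = lp_norm p (image_mset y (mset_set I))"
      have Mr: "M powr r = (\<Sum>i\<in>I. \<bar>y i\<bar> powr r)"
        using 1 by (simp add: M_def lp_norm_finite powr_powr sum_nonneg)
      show "\<bar>\<Sum>i\<in>I. w i * y i\<bar> \<le> M"
      proof (cases "M = 0")
        case True
        then have "\<forall>i\<in>I. y i = 0"
          using Mr I by (simp add: sum_nonneg_eq_0_iff)
        then show ?thesis using True by simp
      next
        case False
        then have M: "M > 0"
          using lp_norm_nonneg[of p "image_mset y (mset_set I)"] by (simp add: M_def)
        have norm1': "(\<Sum>i\<in>I. (\<bar>y i\<bar> / M) powr r) = 1"
          using M by (simp add: powr_divide Mr[symmetric] sum_divide_distrib[symmetric])
        \<comment> \<open>With \<open>y\<close> and \<open>s\<close> both scaled to norm 1, the two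
          sums on the right of Young's inequality are 1 and \<open>r - 1\<close>, which add up to
          \<open>r\<close>.\<close>
        have "r * (\<Sum>i\<in>I. w i * \<bar>y i\<bar>) = M * (\<Sum>i\<in>I. r * (\<bar>y i\<bar> / M * (s i / N) powr (r - 1)))"
          using M by (simp add: sum_distrib_left w_def mult_ac)
        also have "\<dots> \<le> M * (\<Sum>i\<in>I. (\<bar>y i\<bar> / M) powr r + (r - 1) * (s i / N) powr r)"
          using 1 M N s by (intro mult_left_mono sum_mono young_powr) auto
        also have "\<dots> = r * M"
          unfolding sum.distrib sum_distrib_left[symmetric] norm1 norm1' by simp
        finally have "(\<Sum>i\<in>I. w i * \<bar>y i\<bar>) \<le> M"
          using 1 by simp
        moreover have "\<bar>\<Sum>i\<in>I. w i * y i\<bar> \<le> (\<Sum>i\<in>I. w i * \<bar>y i\<bar>)"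
          by (rule order_trans[OF sum_abs]) (simp add: abs_mult w_def)
        ultimately show ?thesis by linarith
      qed
    qed
    ultimately show thesis
      using that[of w] by (simp add: N_def)
  next
    case 2
    \<comment> \<open>The inserted 0 cannot be the maximum because \<open>N\<close> is positive, so
      some index attains it.\<close>
    have "N \<in> insert 0 ((\<lambda>i. \<bar>s i\<bar>) ` I)"
      unfolding N_def 2 lp_norm_infinity[OF I] using I by (intro Max_in) auto
    then obtain k where k: "k \<in> I" "s k = N"
      using N s by auto
    have "(\<Sum>i\<in>I. (if i = k then 1 else 0) * y i) = y k" for y :: "_ \<Rightarrow> real"
      using I k by (simp add: if_distrib[of "\<lambda>x. x * _"] sum.delta cong: if_cong)
    then show thesis
      using that[of "\<lambda>i. if i = k then 1 else 0"] k 2 abs_le_lp_norm_infinity[OF I k(1)]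
      by (simp add: N_def)
  qed
qed

text \<open>For a finite exponent the row sums allow Jensen's inequality for each single
  \<open>y i\<close>, and the column sums control the total after exchanging the order of summation.
  For exponent infinity, an average of total mass at most 1 cannot exceed the largest
  \<open>s j\<close>.\<close>

lemma lp_norm_substochastic_le:
  fixes m :: "'i \<Rightarrow> 'j \<Rightarrow> real"
  assumes p: "1 \<le> p" and I: "finite I" and J: "finite J"
    and m: "\<And>i j. i \<in> I \<Longrightarrow> j \<in> J \<Longrightarrow> 0 \<le> m i j"
    and row: "\<And>i. i \<in> I \<Longrightarrow> (\<Sum>j\<in>J. m i j) \<le> 1"
    and col: "\<And>j. j \<in> J \<Longrightarrow> (\<Sum>i\<in>I. m i j) \<le> 1"
    and s: "\<And>j. j \<in> J \<Longrightarrow> 0 \<le> s j"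
    and y: "\<And>i. i \<in> I \<Longrightarrow> \<bar>y i\<bar> \<le> (\<Sum>j\<in>J. m i j * s j)"
  shows "lp_norm p (image_mset y (mset_set I)) \<le> lp_norm p (image_mset s (mset_set J))"
  using p
proof (cases rule: ereal_ge_one_cases)
  case (1 r)
  (* Jensen's inequality for weights of total mass at most 1; young_powr is the tangent line bound
     of s powr r at the mean c. *)
  have jensen: "\<bar>y i\<bar> powr r \<le> (\<Sum>j\<in>J. m i j * s j powr r)" if i: "i \<in> I" for i
  proof -
    define c where "c = (\<Sum>j\<in>J. m i j * s j)"
    have c: "c \<ge> 0"
      unfolding c_def using i m s by (intro sum_nonneg mult_nonneg_nonneg) auto
    have "r * c powr r = r * (c * c powr (r - 1))"
      using c by (cases "c = 0") (simp_all add: powr_diff)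
    also have "\<dots> = (\<Sum>j\<in>J. m i j * (r * (s j * c powr (r - 1))))"
      unfolding sum_distrib_left sum_distrib_right c_def[abs_def] by (simp add: mult_ac)
    also have "\<dots> \<le> (\<Sum>j\<in>J. m i j * (s j powr r + (r - 1) * c powr r))"
      using 1 c i m s by (intro sum_mono mult_left_mono young_powr) auto
    also have "\<dots> = (\<Sum>j\<in>J. m i j * s j powr r) + (\<Sum>j\<in>J. m i j) * ((r - 1) * c powr r)"
      by (simp only: distrib_left sum.distrib sum_distrib_right)
    also have "\<dots> \<le> (\<Sum>j\<in>J. m i j * s j powr r) + 1 * ((r - 1) * c powr r)"
      using 1 row[OF i] by (intro add_left_mono mult_right_mono) auto
    finally have "c powr r \<le> (\<Sum>j\<in>J. m i j * s j powr r)"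
      by (simp add: algebra_simps)
    moreover have "\<bar>y i\<bar> powr r \<le> c powr r"
      using y[OF i] 1 by (intro powr_mono2) (auto simp: c_def)
    ultimately show ?thesis by linarith
  qed
  have "(\<Sum>i\<in>I. \<bar>y i\<bar> powr r) \<le> (\<Sum>i\<in>I. \<Sum>j\<in>J. m i j * s j powr r)"
    by (intro sum_mono jensen)
  also have "\<dots> = (\<Sum>j\<in>J. (\<Sum>i\<in>I. m i j) * s j powr r)"
    by (subst sum.swap) (simp add: sum_distrib_right)
  also have "\<dots> \<le> (\<Sum>j\<in>J. \<bar>s j\<bar> powr r)"
    using col s by (intro sum_mono) (simp add: mult_left_le_one_le m sum_nonneg)
  finally show ?thesis
    unfolding 1 lp_norm_finite using 1 by (intro powr_mono2) (auto intro: sum_nonneg)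
next
  case 2
  define N where "N = lp_norm \<infinity> (image_mset s (mset_set J))"
  have "N \<ge> 0" by (simp add: N_def lp_norm_nonneg)
  have "\<bar>y i\<bar> \<le> N" if i: "i \<in> I" for i
  proof -
    have "\<bar>y i\<bar> \<le> (\<Sum>j\<in>J. m i j * N)"
      using abs_le_lp_norm_infinity[OF J, of _ s] i m
      by (intro order_trans[OF y[OF i]] sum_mono mult_left_mono) (force simp: N_def)+
    also have "\<dots> \<le> N"
      using row[OF i] \<open>N \<ge> 0\<close> m i
      by (simp add: sum_distrib_right[symmetric] mult_left_le_one_le sum_nonneg)
    finally show ?thesis .
  qed
  then show ?thesis
    using I \<open>N \<ge> 0\<close> unfolding 2 N_def[symmetric] by (simp add: lp_norm_infinity)
qed

(* Vectors of norm < 1 are allowed because the left singular vectors sgn (X *v b) below vanish for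
   the singular value 0. *)
definition suborthonormal :: "'i set \<Rightarrow> ('i \<Rightarrow> 'a::real_inner) \<Rightarrow> bool" where
  "suborthonormal I u \<longleftrightarrow> finite I \<and> (\<forall>i\<in>I. norm (u i) \<le> 1) \<and>
     (\<forall>i\<in>I. \<forall>j\<in>I. i \<noteq> j \<longrightarrow> u i \<bullet> u j = 0)"

section \<open>Bessel's inequality and compressions of a matrix\<close>

text \<open>The sum \<open>z\<close> need not be an orthogonal projection of \<open>x\<close>, since
  the vectors may be shorter than 1. Still \<open>z \<bullet> z \<le> x \<bullet> z\<close>, and
  this suffices when combined with the nonnegativity of the square of \<open>x - z\<close>.\<close>

lemma bessel_suborthonormal:
  assumes "suborthonormal I u"
  shows "(\<Sum>i\<in>I. (u i \<bullet> x)\<^sup>2) \<le> (norm x)\<^sup>2"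
proof -
  have I: "finite I" and u1: "\<And>i. i \<in> I \<Longrightarrow> norm (u i) \<le> 1"
    and u0: "\<And>i j. i \<in> I \<Longrightarrow> j \<in> I \<Longrightarrow> i \<noteq> j \<Longrightarrow> u i \<bullet> u j = 0"
    using assms by (auto simp: suborthonormal_def)
  define z where "z = (\<Sum>i\<in>I. (u i \<bullet> x) *\<^sub>R u i)"
  have xz: "x \<bullet> z = (\<Sum>i\<in>I. (u i \<bullet> x)\<^sup>2)"
    by (simp add: z_def inner_sum_right power2_eq_square inner_commute)
  have uz: "u i \<bullet> z = (u i \<bullet> x) * (u i \<bullet> u i)" if "i \<in> I" for i
  proof -
    have "u i \<bullet> z = (\<Sum>j\<in>I. if j = i then (u i \<bullet> x) * (u i \<bullet> u i) else 0)"
      unfolding z_def inner_sum_right by (rule sum.cong) (use u0 that in auto)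
    then show ?thesis using I that by simp
  qed
  have "z \<bullet> z = (\<Sum>i\<in>I. (u i \<bullet> x) * (u i \<bullet> z))"
    by (subst (1) z_def) (simp add: inner_sum_left)
  also have "\<dots> \<le> (\<Sum>i\<in>I. (u i \<bullet> x)\<^sup>2)"
  proof (rule sum_mono)
    fix i assume i: "i \<in> I"
    have "u i \<bullet> u i \<le> 1"
      using u1[OF i] by (simp add: power2_norm_eq_inner[symmetric] abs_square_le_1 power_le_one)
    then show "(u i \<bullet> x) * (u i \<bullet> z) \<le> (u i \<bullet> x)\<^sup>2"
      using uz[OF i] mult_left_mono[of "u i \<bullet> u i" 1 "(u i \<bullet> x)\<^sup>2"]
      by (simp add: power2_eq_square mult_ac)
  qed
  finally have "z \<bullet> z \<le> x \<bullet> z" by (simp add: xz)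
  moreover have "0 \<le> (x - z) \<bullet> (x - z)" by simp
  ultimately have "x \<bullet> z \<le> x \<bullet> x"
    by (simp add: inner_diff_left inner_diff_right inner_commute)
  then show ?thesis by (simp add: xz power2_norm_eq_inner)
qed

text \<open>Cauchy-Schwarz followed by Bessel for both systems. It supplies the row and column sums
  of the substochastic matrix in the next lemma.\<close>

lemma sum_abs_mult_suborthonormal_le_1:
  assumes "suborthonormal I u" "suborthonormal I v" "norm x \<le> 1" "norm y \<le> 1"
  shows "(\<Sum>i\<in>I. \<bar>u i \<bullet> x\<bar> * \<bar>v i \<bullet> y\<bar>) \<le> 1"
proof -
  have "(\<Sum>i\<in>I. \<bar>u i \<bullet> x\<bar> * \<bar>v i \<bullet> y\<bar>) \<le> L2_set (\<lambda>i. u i \<bullet> x) I * L2_set (\<lambda>i. v i \<bullet> y) I"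
    by (rule L2_set_mult_ineq)
  also have "\<dots> \<le> 1 * 1"
    using bessel_suborthonormal[OF assms(1), of x] bessel_suborthonormal[OF assms(2), of y]
      power_le_one[OF norm_ge_zero assms(3), of 2] power_le_one[OF norm_ge_zero assms(4), of 2]
    by (intro mult_mono) (auto simp: L2_set_def sum_nonneg)
  finally show ?thesis by simp
qed

text \<open>Expanding \<open>v i\<close> in a singular basis of \<open>Z\<close> writes each entry
  of the compression as a combination of the singular values of \<open>Z\<close>, with coefficients
  bounded by \<open>m i b\<close>. The row sums of \<open>m\<close> test the singular systems
  against \<open>u i\<close> and \<open>v i\<close>; the column sums exchange these roles.\<close>

lemma lp_norm_compression_le_schatten:
  fixes Z :: "real^'n^'m"
  assumes p: "1 \<le> p" and u: "suborthonormal I u" and v: "suborthonormal I v"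
  shows "lp_norm p (image_mset (\<lambda>i. u i \<bullet> (Z *v v i)) (mset_set I)) \<le> schatten_norm p Z"
proof -
  obtain B where B: "finite B" "pairwise orthogonal B" "\<And>b. b \<in> B \<Longrightarrow> norm b = 1"
    "span B = UNIV"
    "\<And>b c. b \<in> B \<Longrightarrow> c \<in> B \<Longrightarrow> b \<noteq> c \<Longrightarrow> (Z *v b) \<bullet> (Z *v c) = 0"
    "singular_values Z = image_mset (\<lambda>b. norm (Z *v b)) (mset_set B)"
    using singular_basis[of Z] by blast
  define a where "a b = sgn (Z *v b)" for b
  have ab: "suborthonormal B a" "suborthonormal B (\<lambda>b. b)"
    using B by (auto simp: suborthonormal_def a_def norm_sgn pairwise_def orthogonal_def)
      (simp add: sgn_div_norm)
  have Za: "Z *v b = norm (Z *v b) *\<^sub>R a b" for b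
    by (cases "Z *v b = 0") (simp_all add: a_def sgn_div_norm)
  define m where "m i b = \<bar>a b \<bullet> u i\<bar> * \<bar>b \<bullet> v i\<bar>" for i b
  have fin: "finite I" using u by (simp add: suborthonormal_def)
  show ?thesis
    unfolding schatten_norm_def B(6)
  proof (rule lp_norm_substochastic_le[OF p fin B(1), of m])
    fix i assume i: "i \<in> I"
    show "(\<Sum>b\<in>B. m i b) \<le> 1"
      unfolding m_def using i u v
      by (intro sum_abs_mult_suborthonormal_le_1 ab) (auto simp: suborthonormal_def)
    have "Z *v v i = (\<Sum>b\<in>B. (v i \<bullet> b) *\<^sub>R (Z *v b))"
      by (subst orthonormal_basis_expand[OF B(2,3) _ B(1), of "v i", symmetric])
        (auto simp: B(4) linear_sum[OF matrix_vector_mul_linear] matrix_vector_mult_scaleR)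
    then have "u i \<bullet> (Z *v v i) = (\<Sum>b\<in>B. (v i \<bullet> b) * (norm (Z *v b) * (u i \<bullet> a b)))"
      by (simp add: inner_sum_right) (metis (no_types, lifting) Za inner_scaleR_right sum.cong)
    then show "\<bar>u i \<bullet> (Z *v v i)\<bar> \<le> (\<Sum>b\<in>B. m i b * norm (Z *v b))"
      by (simp only:) (rule order_trans[OF sum_abs],
        simp add: m_def abs_mult inner_commute mult_ac)
  next
    fix b assume b: "b \<in> B"
    have "norm (a b) \<le> 1" "norm b \<le> 1"
      using ab b by (auto simp: suborthonormal_def)
    from sum_abs_mult_suborthonormal_le_1[OF u v this]
    show "(\<Sum>i\<in>I. m i b) \<le> 1"
      by (simp add: m_def inner_commute)
  qed (auto simp: m_def)
qed

section \<open>Norming functionals and properties of the Schatten norm\<close>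

text \<open>This exhibits the Schatten norm as a pointwise maximum of linear functionals. Besides
  driving the adversary, it yields convexity and the value at 0.\<close>

lemma schatten_norming_functional:
  fixes X :: "real^'n^'m"
  assumes p: "1 \<le> p"
  obtains f where "linear f" "f X = schatten_norm p X" "\<And>Z. \<bar>f Z\<bar> \<le> schatten_norm p Z"
proof -
  obtain B where B: "finite B" "pairwise orthogonal B" "\<And>b. b \<in> B \<Longrightarrow> norm b = 1"
    "span B = UNIV"
    "\<And>b c. b \<in> B \<Longrightarrow> c \<in> B \<Longrightarrow> b \<noteq> c \<Longrightarrow> (X *v b) \<bullet> (X *v c) = 0"
    "singular_values X = image_mset (\<lambda>b. norm (X *v b)) (mset_set B)"
    using singular_basis[of X] by blast
  define a where "a b = sgn (X *v b)" for b
  have ab: "suborthonormal B a" "suborthonormal B (\<lambda>b. b)"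
    using B by (auto simp: suborthonormal_def a_def norm_sgn pairwise_def orthogonal_def)
      (simp add: sgn_div_norm)
  have aX: "a b \<bullet> (X *v b) = norm (X *v b)" for b
    by (cases "X *v b = 0")
      (simp_all add: a_def sgn_div_norm power2_norm_eq_inner[symmetric] power2_eq_square)
  obtain w where w: "(\<Sum>b\<in>B. w b * norm (X *v b)) = schatten_norm p X"
    "\<And>y. \<bar>\<Sum>b\<in>B. w b * y b\<bar> \<le> lp_norm p (image_mset y (mset_set B))"
    using lp_norm_norming_weights[OF p B(1), of "\<lambda>b. norm (X *v b)"]
    by (auto simp: schatten_norm_def B(6))
  define f where "f Z = (\<Sum>b\<in>B. w b * (a b \<bullet> (Z *v b)))" for Z :: "real^'n^'m"
  show thesis
  proof
    show "linear f"
      by (rule linearI)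
        (simp_all add: f_def matrix_vector_mult_add_rdistrib scaleR_matrix_vector_assoc[symmetric]
          inner_add_right sum.distrib sum_distrib_left algebra_simps)
    show "f X = schatten_norm p X"
      by (simp add: f_def aX w(1))
    show "\<bar>f Z\<bar> \<le> schatten_norm p Z" for Z
      unfolding f_def by (rule order_trans[OF w(2) lp_norm_compression_le_schatten[OF p ab]])
  qed
qed

text \<open>A functional norming the convex combination splits over it and is bounded by the norm at
  both end points. Convexity is proved for the sake of continuity, which follows from it on a
  finite-dimensional space.\<close>

lemma convex_on_schatten_norm:
  assumes "1 \<le> p"
  shows "convex_on UNIV (schatten_norm p :: real^'n^'m \<Rightarrow> real)"
proof (rule convex_onI)
  fix t :: real and X Y :: "real^'n^'m"
  assume t: "0 < t" "t < 1"
  obtain f where f: "linear f" "f ((1 - t) *\<^sub>R X + t *\<^sub>R Y) = schatten_norm p ((1 - t) *\<^sub>R X + t *\<^sub>R Y)"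
    "\<And>Z. \<bar>f Z\<bar> \<le> schatten_norm p Z"
    using schatten_norming_functional[OF assms, of "(1 - t) *\<^sub>R X + t *\<^sub>R Y"] by blast
  have "schatten_norm p ((1 - t) *\<^sub>R X + t *\<^sub>R Y) = (1 - t) * f X + t * f Y"
    by (simp only: f(2)[symmetric] linear_add[OF f(1)] linear_scale[OF f(1)] real_scaleR_def)
  also have "\<dots> \<le> (1 - t) * schatten_norm p X + t * schatten_norm p Y"
    using t f(3)[of X] f(3)[of Y] by (intro add_mono mult_left_mono) auto
  finally show "schatten_norm p ((1 - t) *\<^sub>R X + t *\<^sub>R Y)
      \<le> (1 - t) * schatten_norm p X + t * schatten_norm p Y" .
qed simp

lemma schatten_norm_zero:
  assumes "1 \<le> p"
  shows "schatten_norm p (0 :: real^'n^'m) = 0"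
proof -
  obtain f where "linear f" "f (0 :: real^'n^'m) = schatten_norm p (0 :: real^'n^'m)"
    by (rule schatten_norming_functional[OF assms, of 0])
  then show ?thesis by (simp add: linear_0)
qed

lemma schatten_norm_nonneg: "0 \<le> schatten_norm p X"
  by (simp add: schatten_norm_def lp_norm_nonneg)

text \<open>An entry is a compression to a single pair of standard basis vectors. The bound makes
  the penalty coercive, which is needed for the existence of minimizers.\<close>

lemma abs_entry_le_schatten_norm:
  fixes Z :: "real^'n^'m"
  assumes "1 \<le> p"
  shows "\<bar>Z $ i $ j\<bar> \<le> schatten_norm p Z"
proof -
  have "suborthonormal {()} (\<lambda>_. axis i 1 :: real^'m)" "suborthonormal {()} (\<lambda>_. axis j 1 :: real^'n)"
    by (auto simp: suborthonormal_def)
  from lp_norm_compression_le_schatten[OF assms this, of Z]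
  have *: "lp_norm p (image_mset (\<lambda>_. Z $ i $ j) (mset_set {()})) \<le> schatten_norm p Z"
    by (simp add: inner_axis' matrix_vector_mul_component inner_axis)
  from assms show ?thesis
  proof (cases rule: ereal_ge_one_cases)
    case (1 r)
    then show ?thesis using * 1(2) by (simp only: 1(1) lp_norm_finite) (simp add: powr_powr split: if_splits)
  next
    case 2
    then show ?thesis using * by (simp only: 2) (simp add: lp_norm_def)
  qed
qed

lemma schatten_norm_one: "schatten_norm 1 X = nuclear_norm X"
  for X :: "real^'n^'m"
proof -
  obtain B where B: "singular_values X = image_mset (\<lambda>b. norm (X *v b)) (mset_set B)"
    by (rule singular_basis)
  show ?thesis
    unfolding schatten_norm_def nuclear_norm_def B one_ereal_def lp_norm_finite
    by (simp add: sum_unfold_sum_mset multiset.map_comp o_def sum_nonneg flip: sum_unfold_sum_mset)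
qed

section \<open>The projected Frobenius seminorm and its worst direction\<close>

lemma proj_frob_L2_set: "proj_frob E Z = L2_set (\<lambda>(i, j). Z $ i $ j) E"
  by (simp add: proj_frob_def L2_set_def case_prod_unfold)

lemma proj_frob_nonneg: "0 \<le> proj_frob E Z"
  by (simp add: proj_frob_L2_set)

lemma proj_frob_diff_le: "proj_frob E (Z - W) \<le> proj_frob E Z + proj_frob E W"
proof -
  have "proj_frob E (Z - W) = L2_set (\<lambda>e. (\<lambda>(i, j). Z $ i $ j) e + (\<lambda>(i, j). - W $ i $ j) e) E"
    by (simp add: proj_frob_L2_set case_prod_unfold)
  also have "\<dots> \<le> proj_frob E Z + L2_set (\<lambda>(i, j). - W $ i $ j) E"
    unfolding proj_frob_L2_set by (rule L2_set_triangle_ineq)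
  finally show ?thesis
    by (simp add: proj_frob_L2_set L2_set_def case_prod_unfold)
qed

lemma proj_frob_scaleR: "proj_frob E (c *\<^sub>R Z) = \<bar>c\<bar> * proj_frob E Z"
  by (simp add: proj_frob_def power_mult_distrib case_prod_unfold sum_distrib_left[symmetric]
      real_sqrt_mult)

lemma proj_frob_eq_0_iff: "proj_frob E Z = 0 \<longleftrightarrow> (\<forall>(i, j)\<in>E. Z $ i $ j = 0)"
  for Z :: "real^'n::finite^'m::finite"
  by (simp add: proj_frob_L2_set L2_set_eq_0_iff case_prod_unfold)

text \<open>The triangle inequality is an equality for opposite directions, so \<open>V\<close> is
  the negative normalized \<open>R\<close>. If \<open>R\<close> vanishes on \<open>E\<close>, any
  \<open>V\<close> of seminorm 1 will do, and the unit matrix at one observed position is such a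
  \<open>V\<close>.\<close>

lemma proj_frob_worst_direction:
  fixes R :: "real^'n^'m"
  assumes "E \<noteq> {}"
  obtains V where "proj_frob E V = 1"
    "\<And>c. 0 \<le> c \<Longrightarrow> proj_frob E (R - c *\<^sub>R V) = proj_frob E R + c"
proof (cases "proj_frob E R = 0")
  case True
  obtain i j where ij: "(i, j) \<in> E"
    using assms by auto
  define V :: "real^'n^'m" where "V = axis i (axis j 1)"
  have "(\<Sum>(k, l)\<in>E. (V $ k $ l)\<^sup>2) = (\<Sum>e\<in>E. if e = (i, j) then 1 else 0)"
    by (rule sum.cong) (auto simp: V_def axis_def split: if_splits)
  then have V: "proj_frob E V = 1"
    using ij by (simp add: proj_frob_def)
  have "proj_frob E (R - c *\<^sub>R V) = proj_frob E R + c" if "0 \<le> c" for c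
  proof -
    have "proj_frob E (R - c *\<^sub>R V) = proj_frob E ((- c) *\<^sub>R V)"
      unfolding proj_frob_def using True
      by (intro arg_cong[of _ _ sqrt] sum.cong) (auto simp: proj_frob_eq_0_iff)
    then show ?thesis
      using True V that by (simp only: proj_frob_scaleR)
  qed
  with V that show thesis by blast
next
  case False
  then have pos: "proj_frob E R > 0"
    using proj_frob_nonneg[of E R] by linarith
  define V where "V = (- 1 / proj_frob E R) *\<^sub>R R"
  have "proj_frob E V = 1"
    unfolding V_def proj_frob_scaleR using pos by simp
  moreover have "proj_frob E (R - c *\<^sub>R V) = proj_frob E R + c" if "0 \<le> c" for c
  proof -
    have "R - c *\<^sub>R V = (1 + c / proj_frob E R) *\<^sub>R R"
      by (simp add: V_def scaleR_left_distrib)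
    then have "proj_frob E (R - c *\<^sub>R V) = \<bar>1 + c / proj_frob E R\<bar> * proj_frob E R"
      by (simp only: proj_frob_scaleR)
    then show ?thesis
      using pos that by (simp add: distrib_right)
  qed
  ultimately show thesis using that by blast
qed

section \<open>Attainment of the minimum and of the inner maximum\<close>

lemma continuous_on_penalized_objective:
  fixes Y :: "real^'n^'m"
  assumes "1 \<le> p"
  shows "continuous_on UNIV (\<lambda>X. proj_frob E (Y - X) + lam * schatten_norm p X)"
proof -
  have "continuous_on UNIV (schatten_norm p :: real^'n^'m \<Rightarrow> real)"
    by (rule convex_on_continuous[OF open_UNIV convex_on_schatten_norm[OF assms]])
  then show ?thesis
    unfolding proj_frob_def case_prod_unfold by (intro continuous_intros) auto
qed

lemma penalized_objective_attains_min:
  fixes Y :: "real^'n^'m"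
  assumes lam: "0 < lam" and p: "1 \<le> p"
  obtains X where "\<And>Z. proj_frob E (Y - X) + lam * schatten_norm p X
      \<le> proj_frob E (Y - Z) + lam * schatten_norm p Z"
proof -
  define g where "g X = proj_frob E (Y - X) + lam * schatten_norm p X" for X
  \<comment> \<open>The sublevel set at the value of the zero matrix is nonempty, closed by
    continuity, and bounded because \<open>lam\<close> times the Schatten norm, and hence every
    entry, is bounded on it.\<close>
  define K where "K = {X. g X \<le> g 0}"
  have cont: "continuous_on UNIV g"
    unfolding g_def[abs_def] by (rule continuous_on_penalized_objective[OF p])
  have "closed K"
    unfolding K_def using cont by (intro closed_Collect_le) auto
  moreover have "bounded K"
  proof (rule boundedI)
    fix X assume "X \<in> K"
    then have "lam * schatten_norm p X \<le> g 0"
      using proj_frob_nonneg[of E "Y - X"] by (simp add: K_def g_def)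
    then have *: "schatten_norm p X \<le> g 0 / lam"
      using lam by (simp add: field_simps)
    have "norm X \<le> (\<Sum>i\<in>UNIV. norm (X $ i))"
      by (simp add: norm_vec_def L2_set_le_sum)
    also have "\<dots> \<le> (\<Sum>i::'m\<in>UNIV. \<Sum>j::'n\<in>UNIV. \<bar>X $ i $ j\<bar>)"
      by (intro sum_mono norm_le_l1_cart)
    also have "\<dots> \<le> (\<Sum>i::'m\<in>UNIV. \<Sum>j::'n\<in>UNIV. g 0 / lam)"
      by (intro sum_mono order_trans[OF abs_entry_le_schatten_norm[OF p] *])
    finally show "norm X \<le> (\<Sum>i::'m\<in>UNIV. \<Sum>j::'n\<in>UNIV. g 0 / lam)" .
  qed
  ultimately have "compact K"
    by (simp add: compact_eq_bounded_closed)
  moreover have "0 \<in> K" by (simp add: K_def)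
  ultimately obtain X where "X \<in> K" "\<And>Z. Z \<in> K \<Longrightarrow> g X \<le> g Z"
    using continuous_attains_inf[of K g] continuous_on_subset[OF cont] by blast
  \<comment> \<open>Outside \<open>K\<close> the objective exceeds \<open>g 0\<close>, which is at
    least \<open>g X\<close>.\<close>
  then have "g X \<le> g Z" for Z
    unfolding K_def mem_Collect_eq by (meson linear order_trans)
  then show thesis by (intro that[of X]) (simp add: g_def)
qed

lemma robust_loss_attains_max:
  fixes X Y :: "real^'n^'m"
  assumes lam: "0 < lam" and p: "1 \<le> p" and E: "E \<noteq> {}"
  obtains D where "D \<in> uncertainty_set lam p E"
    "proj_frob E (Y - X - D X) = proj_frob E (Y - X) + lam * schatten_norm p X"
proof -
  obtain f where f: "linear f" "f X = schatten_norm p X" "\<And>Z. \<bar>f Z\<bar> \<le> schatten_norm p Z"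
    using schatten_norming_functional[OF p, of X] by blast
  obtain V where V: "proj_frob E V = 1"
    "\<And>c. 0 \<le> c \<Longrightarrow> proj_frob E (Y - X - c *\<^sub>R V) = proj_frob E (Y - X) + c"
    using proj_frob_worst_direction[OF E, of "Y - X"] by blast
  \<comment> \<open>The factor \<open>f\<close> gives the perturbation its full permitted length at
    \<open>X\<close>, and \<open>V\<close> turns it against the residual. The bound on
    \<open>f\<close> at all other matrices keeps \<open>D\<close> in the uncertainty set.\<close>
  define D where "D Z = (lam * f Z) *\<^sub>R V" for Z
  have "linear D"
    by (rule linearI)
      (simp_all add: D_def linear_add[OF f(1)] linear_scale[OF f(1)] algebra_simps)
  moreover have "proj_frob E (D Z) \<le> lam * schatten_norm p Z" for Z
    unfolding D_def proj_frob_scaleR using lam f(3)[of Z] V(1) by (simp add: abs_mult)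
  moreover have "proj_frob E (Y - X - D X) = proj_frob E (Y - X) + lam * schatten_norm p X"
    unfolding D_def f(2) using lam by (intro V(2)) (simp add: schatten_norm_nonneg)
  ultimately show thesis
    using that[of D] by (simp add: uncertainty_set_def)
qed

lemma robust_loss_le:
  assumes "D \<in> uncertainty_set lam p E"
  shows "proj_frob E (Y - X - D X) \<le> proj_frob E (Y - X) + lam * schatten_norm p X"
  using assms proj_frob_diff_le[of E "Y - X" "D X"]
  by (auto simp: uncertainty_set_def intro: order_trans)

text \<open>On the reals \<open>SUP\<close> and \<open>INF\<close> are total and say nothing about
  attainment by themselves. The existence clauses for \<open>is_arg_max\<close> and
  \<open>is_arg_min\<close> ensure that they denote genuine maxima and minima.\<close>

theorem corollary3:
  fixes lam :: real
    and p :: ereal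
    and E :: "('m::finite \<times> 'n::finite) set"
    and Y :: "real^'n^'m"
  assumes "0 < lam" and "1 \<le> p"
  shows
    "(\<forall>X. \<exists>D. is_arg_max (\<lambda>D. proj_frob E (Y - X - D X)) (\<lambda>D. D \<in> uncertainty_set lam p E) D) \<and>
     (\<exists>X. is_arg_min (\<lambda>X. SUP D\<in>uncertainty_set lam p E. proj_frob E (Y - X - D X)) (\<lambda>X. True) X) \<and>
     (\<exists>X. is_arg_min (\<lambda>X. proj_frob E (Y - X) + lam * schatten_norm p X) (\<lambda>X. True) X) \<and>
     (INF X. SUP D\<in>uncertainty_set lam p E. proj_frob E (Y - X - D X)) =
       (INF X. proj_frob E (Y - X) + lam * schatten_norm p X) \<and>
     (p = 1 \<longrightarrow>
       (\<lambda>X. proj_frob E (Y - X) + lam * schatten_norm p X) =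
       (\<lambda>X. proj_frob E (Y - X) + lam * nuclear_norm X))"
proof -
  define g where "g X = proj_frob E (Y - X) + lam * schatten_norm p X" for X
  \<comment> \<open>The true inner maximum. For empty \<open>E\<close> the seminorm is identically
    0, so the maximum is 0 although the penalty in \<open>g\<close> may be positive; the two sides
    then agree only after minimization.\<close>
  define h where "h X = (if E = {} then 0 else g X)" for X
  define U where "U = uncertainty_set lam p E"
  have attained: "\<exists>D\<in>U. proj_frob E (Y - X - D X) = h X" for X
  proof (cases "E = {}")
    case True
    have "(\<lambda>_. 0) \<in> U"
      using assms(1) by (auto simp: U_def uncertainty_set_def proj_frob_def module_hom_zero schatten_norm_nonneg)
    then show ?thesis
      using True by (intro bexI[of _ "\<lambda>_. 0"]) (auto simp: h_def proj_frob_def)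
  next
    case False
    then show ?thesis
      using robust_loss_attains_max[OF assms False, of Y X] by (auto simp: h_def g_def U_def)
  qed
  have upper: "proj_frob E (Y - X - D X) \<le> h X" if "D \<in> U" for D X
  proof (cases "E = {}")
    case True
    then show ?thesis by (simp add: h_def proj_frob_def)
  next
    case False
    then show ?thesis
      using robust_loss_le[of D lam p E Y X] that by (simp add: h_def g_def U_def)
  qed
  have SUP_eq: "(SUP D\<in>U. proj_frob E (Y - X - D X)) = h X" for X
    by (rule cSup_eq_maximum) (use attained[of X] upper in force)+
  obtain X0 where X0: "\<And>Z. g X0 \<le> g Z"
    using penalized_objective_attains_min[OF assms, of E Y] unfolding g_def by blast
  have h_min: "h X0 \<le> h Z" for Z
    using X0 by (simp add: h_def)
  \<comment> \<open>For empty \<open>E\<close> the zero matrix brings the penalized objective down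
    to 0, so its minimum equals the constant value of \<open>h\<close>.\<close>
  have "g 0 = 0" "\<And>Z. 0 \<le> g Z" if "E = {}"
    using that assms by (simp_all add: g_def proj_frob_def schatten_norm_zero schatten_norm_nonneg)
  then have "g X0 = h X0"
    using X0[of 0] by (cases "E = {}") (auto simp: h_def intro: antisym)
  moreover have "(INF X. h X) = h X0" "(INF X. g X) = g X0"
    by (rule cInf_eq_minimum; use X0 h_min in force)+
  ultimately have INF_eq: "(INF X. h X) = (INF X. g X)"
    by simp
  have max: "\<exists>D. is_arg_max (\<lambda>D. proj_frob E (Y - X - D X)) (\<lambda>D. D \<in> U) D" for X
  proof -
    obtain D where "D \<in> U" "proj_frob E (Y - X - D X) = h X"
      using attained by blast
    then have "is_arg_max (\<lambda>D. proj_frob E (Y - X - D X)) (\<lambda>D. D \<in> U) D"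
      using upper by (simp add: is_arg_max_linorder)
    then show ?thesis by (intro exI[of _ D])
  qed
  have "is_arg_min h (\<lambda>X. True) X0" "is_arg_min g (\<lambda>X. True) X0"
    using X0 h_min by (simp_all add: is_arg_min_linorder)
  with max INF_eq show ?thesis
    unfolding U_def[symmetric] SUP_eq g_def[symmetric]
    by (auto simp: g_def[abs_def] schatten_norm_one)
qed
end
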